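(* Let $n\ge2$, let $d=2k$ be an even positive integer, and let $A\in M_n(\mathbb{C})$ have singular values $s_1(A)\ge\cdots\ge s_n(A)\ge0$. Define $$\|A\|_{H_d}:=h_d\big(s_1(A),\ldots,s_n(A)\big)^{1/d}.$$ Then $$\binom{n+2k-1}{2k}^{1/2k}|t_{n,k}|\,\|A\|_{\mathrm{op}}\ \le\ \|A\|_{H_{2k}}\ \le\ \binom{n+2k-1}{2k}^{1/2k}\|A\|_{\mathrm{op}},$$ where $t_{n,k}$ is the unique number in $(-1,0)$ such that $$h_{2k-1}(\underbrace{t_{n,k},\ldots,t_{n,k}}_{n},1)=0,$$ and the bound is optimal. Equality in the lower bound can occur only if the normalised singular-value vector $s(A)/\|A\|_{\mathrm{op}}$ is a minimiser of $h_d$ on $S_\infty^{n-1}=\{x\in\mathbb{R}^n:\|x\|_\infty=1\}$.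
   Context: For an integer $m\ge 0$ and any number of variables, $h_m$ denotes the complete homogeneous symmetric polynomial of degree $m$: $h_m(a_1,\ldots,a_N)=\sum_{1\le i_1\le\cdots\le i_m\le N}a_{i_1}\cdots a_{i_m}$, with $h_0=1$. $\|A\|_{\mathrm{op}}=s_1(A)$ is the operator norm, and $s(A)=(s_1(A),\ldots,s_n(A))$.
   Formalization: Optimality of the lower constant is stated for h_d on real vectors with the max norm: over matrices it fails (singular values are nonnegative, so the best constant is 1; n=2, k=1 gives √3/2<1). The upper constant is optimal over matrices. The equality clause assumes A≠0. *)

theory Defs
  imports "HOL-Analysis.Analysis" "HOL-Computational_Algebra.Polynomial" "HOL-Library.Multiset"
begin

definition chs :: "nat \<Rightarrow> real list \<Rightarrow> real" where
  "chs m xs = (\<Sum>is | length is = m \<and> sorted is \<and> set is \<subseteq> {..<length xs}. \<Prod>i\<leftarrow>is. xs ! i)"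

definition conj_transpose :: "complex^'n^'m \<Rightarrow> complex^'m^'n" where
  "conj_transpose A = map_matrix cnj (transpose A)"

definition charpoly :: "complex^'n^'n \<Rightarrow> complex poly" where
  "charpoly M = det (mat [:0, 1:] - map_matrix (\<lambda>c. [:c:]) M)"

(* The singular values in non-increasing order: the square roots of the eigenvalues of A^* A,
   taken with algebraic multiplicity (these eigenvalues are real and nonnegative, so Re only
   changes the type). *)
definition singular_values :: "complex^'n^'n \<Rightarrow> real list" where
  "singular_values A =
     rev (sorted_list_of_multiset
       (image_mset (\<lambda>z. sqrt (Re z)) (proots (charpoly (conj_transpose A ** A)))))"

definition op_norm :: "complex^'n^'n \<Rightarrow> real" where
  "op_norm A = onorm (\<lambda>v. A *v v)"

definition chs_norm :: "nat \<Rightarrow> complex^'n^'n \<Rightarrow> real" where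
  "chs_norm d A = root d (chs d (singular_values A))"

(* Vectors of R^n are lists of length n; only used for n > 0. *)
definition linf_norm :: "real list \<Rightarrow> real" where
  "linf_norm xs = Max (abs ` set xs)"

definition linf_sphere :: "nat \<Rightarrow> real list set" where
  "linf_sphere n = {xs. length xs = n \<and> linf_norm xs = 1}"

definition is_chs_root :: "nat \<Rightarrow> nat \<Rightarrow> real \<Rightarrow> bool" where
  "is_chs_root n k t \<longleftrightarrow> t \<in> {-1<..<0} \<and> chs (2 * k - 1) (replicate n t @ [1]) = 0"

definition chs_root :: "nat \<Rightarrow> nat \<Rightarrow> real" where
  "chs_root n k = (THE t. is_chs_root n k t)"

definition chs_const :: "nat \<Rightarrow> nat \<Rightarrow> real" where
  "chs_const n k = root (2 * k) (real ((n + 2 * k - 1) choose (2 * k)))"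

end

theory Submission
  imports Defs "HOL-Computational_Algebra.Formal_Power_Series"
    "HOL-Computational_Algebra.Fundamental_Theorem_Algebra"
begin

text \<open>
  The operator norm of \<open>A\<close> is the maximum norm of its singular-value vector, so everything reduces to
  comparing \<open>h\<^sub>d(x)\<close> with \<open>\<parallel>x\<parallel>\<^sub>\<infinity>\<close> for real vectors \<open>x\<close> of length \<open>n\<close>. For the upper
  bound, \<open>h\<^sub>d\<close> is monotone on nonnegative vectors, and its value at a constant vector is a binomial
  coefficient times a power; the identity matrix attains it.

  The lower bound rests on one identity (\<open>hsym_exchange\<close>): if \<open>a + b = c + e\<close>, then
  \<open>h\<^sub>m\<^sub>+\<^sub>2(a,b,z) - h\<^sub>m\<^sub>+\<^sub>2(c,e,z) = (c - a)(b - c) h\<^sub>m(a,b,c,e,z)\<close>. With \<open>m\<close> even and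
  \<open>a < c < b\<close> the right-hand side is nonnegative once \<open>h\<^sub>m\<close> is known to be nonnegative, so moving
  two entries towards each other lowers \<open>h\<^sub>m\<^sub>+\<^sub>2\<close>. Taking \<open>c\<close> to be the mean of a group of entries
  makes one more entry equal to the mean, hence finitely many moves make the whole group constant
  (\<open>hsym_mean_le\<close>). Applied to all entries this gives, by induction on the degree, that \<open>h\<^sub>m\<close> is
  nonnegative for even \<open>m\<close>, and positive at every nonzero vector (\<open>hsym_nonneg\<close>, \<open>hsym_pos\<close>).
  Through the divided difference formula \<open>hsym_diff\<close>, \<open>h\<^sub>m\<close> is then strictly increasing in each
  entry for odd \<open>m\<close>; this gives existence and uniqueness of the root \<open>t\<close> (\<open>ex1_chs_root\<close>).

  By homogeneity a nonzero vector may be scaled so that an entry of largest modulus becomes \<open>1\<close>.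
  Averaging the other entries leaves the function \<open>s \<mapsto> h\<^sub>2\<^sub>k(s,\<dots>,s,1)\<close> of one variable, whose
  derivative is a positive multiple of \<open>h\<^sub>2\<^sub>k\<^sub>-\<^sub>1(s,\<dots>,s,s,1)\<close>. Hence it is minimal at \<open>s = t\<close>
  (\<open>hsym_replicate_min\<close>, by finite differences), and there its value is the binomial coefficient
  times \<open>t\<^sup>2\<^sup>k\<close> (\<open>hsym_at_root\<close>). The minimum is attained on the sphere because \<open>\<bar>t\<bar> < 1\<close>, which
  gives both the optimality of the constant and the description of the case of equality.
\<close>

section \<open>Complete homogeneous symmetric polynomials and their exchange identity\<close>

text \<open>
  The generating function \<open>\<Prod>\<^sub>x 1 / (1 - x T)\<close> of the complete homogeneous symmetric polynomials.
  Over multisets, symmetry is built in, so entries can be regrouped freely.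
\<close>
definition hsym_fps :: "real multiset \<Rightarrow> real fps" where
  "hsym_fps M = (\<Prod>x\<in>#M. inverse (1 - fps_const x * fps_X))"

definition hsym :: "nat \<Rightarrow> real multiset \<Rightarrow> real" where
  "hsym m M = fps_nth (hsym_fps M) m"

lemma hsym_fps_add_mset:
  "hsym_fps (add_mset x M) = hsym_fps M + fps_const x * (fps_X * hsym_fps (add_mset x M))"
proof -
  have "(1 - fps_const x * fps_X) * inverse (1 - fps_const x * fps_X) = (1 :: real fps)"
    by (rule inverse_mult_eq_1') simp
  then have "(1 - fps_const x * fps_X) * hsym_fps (add_mset x M) = hsym_fps M"
    by (simp add: hsym_fps_def flip: mult.assoc)
  then show ?thesis
    by (simp add: algebra_simps)
qed

lemma hsym_0 [simp]: "hsym 0 M = 1"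
  by (induction M) (simp_all add: hsym_def hsym_fps_def)

lemma hsym_Suc_empty [simp]: "hsym (Suc m) {#} = 0"
  by (simp add: hsym_def hsym_fps_def)

text \<open>
  Split the monomials by whether they contain \<open>x\<close>. This recursion and the two boundary values
  determine the polynomials, and all later facts are derived from it.
\<close>
lemma hsym_Suc_add_mset:
  "hsym (Suc m) (add_mset x M) = hsym (Suc m) M + x * hsym m (add_mset x M)"
  unfolding hsym_def by (subst hsym_fps_add_mset) simp

text \<open>
  A nonempty sorted index list either contains \<open>0\<close>, necessarily as its head, or is the shift by one
  of an index list for the tail; so \<open>chs\<close> satisfies the recursion of \<open>hsym_Suc_add_mset\<close>.
\<close>
lemma chs_eq_hsym: "chs m xs = hsym m (mset xs)"
proof -
  define S where
    "S m l = {is. length is = m \<and> sorted is \<and> set is \<subseteq> {..<l}}" for m l :: nat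
  have S_0: "S 0 l = {[]}" for l
    by (auto simp: S_def)
  have S_Suc_0: "S (Suc m) 0 = {}" for m
    by (auto simp: S_def)
  have fin: "finite (S m l)" for m l
    by (rule finite_subset[OF _ finite_lists_length_eq[of "{..<l}" m]]) (auto simp: S_def)
  have S_Suc: "S (Suc m) (Suc l) = map Suc ` S (Suc m) l \<union> (#) 0 ` S m (Suc l)" for m l
  proof (intro equalityI subsetI)
    fix js assume js: "js \<in> S (Suc m) (Suc l)"
    show "js \<in> map Suc ` S (Suc m) l \<union> (#) 0 ` S m (Suc l)"
    proof (cases "0 \<in> set js")
      case True
      with js obtain js' where "js = 0 # js'" by (cases js) (auto simp: S_def)
      with js show ?thesis by (auto simp: S_def)
    next
      case False
      define ks where "ks = map (\<lambda>i. i - 1) js"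
      have "Suc (i - 1) = i" if "i \<in> set js" for i
        using False that by (cases i) auto
      then have eq: "js = map Suc ks"
        by (simp add: ks_def o_def map_idI)
      then have "ks \<in> S (Suc m) l"
        using js by (auto simp: S_def sorted_map)
      with eq show ?thesis by blast
    qed
  next
    fix js assume "js \<in> map Suc ` S (Suc m) l \<union> (#) 0 ` S m (Suc l)"
    then show "js \<in> S (Suc m) (Suc l)"
      by (auto simp: S_def sorted_map)
  qed
  have chs_S: "chs m xs = (\<Sum>js\<in>S m (length xs). \<Prod>i\<leftarrow>js. xs ! i)" for m xs
    by (simp add: chs_def S_def)
  have chs_Cons: "chs (Suc m) (x # xs) = chs (Suc m) xs + x * chs m (x # xs)" for m x xs
  proof -
    have disj: "map Suc ` S (Suc m) (length xs) \<inter> (#) 0 ` S m (Suc (length xs)) = {}"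
      by auto
    have "inj_on (map Suc) (S (Suc m) (length xs))" "inj_on ((#) 0) (S m (Suc (length xs)))"
      by (auto intro!: inj_onI)
    then show ?thesis
      unfolding chs_S using fin disj
      by (simp add: S_Suc sum.union_disjoint sum.reindex o_def sum_distrib_left)
  qed
  show ?thesis
  proof (induction m arbitrary: xs)
    case 0
    then show ?case by (simp add: chs_S S_0)
  next
    case (Suc m)
    show ?case
      by (induction xs) (simp_all add: chs_S[of _ "[]"] S_Suc_0 chs_Cons hsym_Suc_add_mset Suc)
  qed
qed

text \<open>
  The divided difference formula: expand \<open>h\<^sub>m\<^sub>+\<^sub>1(a,b,M)\<close> once along \<open>a\<close> and once along \<open>b\<close>.
  It replaces the partial derivative \<open>\<partial>h\<^sub>m\<^sub>+\<^sub>1/\<partial>a = h\<^sub>m(a,a,M)\<close>, its limit for \<open>b \<rightarrow> a\<close>.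
\<close>
lemma hsym_diff:
  "hsym (Suc m) (add_mset a M) - hsym (Suc m) (add_mset b M)
     = (a - b) * hsym m (add_mset a (add_mset b M))"
  using hsym_Suc_add_mset[of m a "add_mset b M"] hsym_Suc_add_mset[of m b "add_mset a M"]
  by (simp add: add_mset_commute algebra_simps)

text \<open>
  A second-order divided difference: replace \<open>a\<close> by \<open>c\<close>, then \<open>b\<close> by \<open>a + b - c\<close>, and subtract.
  When \<open>c\<close> lies between \<open>a\<close> and \<open>b\<close> the factor \<open>(c - a)(b - c)\<close> is nonnegative, so the sign is
  decided by a polynomial of degree lower by two.
\<close>
lemma hsym_exchange:
  "hsym (Suc (Suc m)) (add_mset a (add_mset b M))
     - hsym (Suc (Suc m)) (add_mset c (add_mset (a + b - c) M))
   = (c - a) * (b - c) * hsym m (add_mset a (add_mset b (add_mset c (add_mset (a + b - c) M))))"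
proof -
  define e where "e = a + b - c"
  let ?h = "hsym (Suc m)"
  have 1: "hsym (Suc (Suc m)) (add_mset a (add_mset b M))
      - hsym (Suc (Suc m)) (add_mset c (add_mset b M))
      = (a - c) * ?h (add_mset a (add_mset b (add_mset c M)))"
    using hsym_diff[of "Suc m" a "add_mset b M" c] by (simp add: add_mset_commute)
  have 2: "hsym (Suc (Suc m)) (add_mset c (add_mset b M))
      - hsym (Suc (Suc m)) (add_mset c (add_mset e M))
      = (c - a) * ?h (add_mset e (add_mset b (add_mset c M)))"
    using hsym_diff[of "Suc m" b "add_mset c M" e] by (simp add: add_mset_commute e_def)
  have 3: "?h (add_mset a (add_mset b (add_mset c M))) - ?h (add_mset e (add_mset b (add_mset c M)))
      = (a - e) * hsym m (add_mset a (add_mset b (add_mset c (add_mset e M))))"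
    using hsym_diff[of m a "add_mset b (add_mset c M)" e] by (simp add: add_mset_commute)
  have "hsym (Suc (Suc m)) (add_mset a (add_mset b M))
      - hsym (Suc (Suc m)) (add_mset c (add_mset e M))
    = (a - c) * (?h (add_mset a (add_mset b (add_mset c M)))
        - ?h (add_mset e (add_mset b (add_mset c M))))"
    using 1 2 by (simp add: algebra_simps)
  also have "\<dots> = (a - c) * ((a - e) * hsym m (add_mset a (add_mset b (add_mset c (add_mset e M)))))"
    by (simp only: 3)
  also have "(a - c) * ((a - e) * u) = (c - a) * (b - c) * u" for u
    by (simp add: e_def algebra_simps)
  finally show ?thesis by (simp only: e_def)
qed

lemma hsym_scale: "hsym m (image_mset ((*) c) M) = c ^ m * hsym m M"
proof (induction m arbitrary: M)
  case (Suc m)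
  show ?case
  proof (induction M)
    case (add x M)
    have "hsym m (add_mset (c * x) (image_mset ((*) c) M)) = c ^ m * hsym m (add_mset x M)"
      using Suc.IH[of "add_mset x M"] by simp
    with add.IH show ?case
      by (simp add: hsym_Suc_add_mset distrib_left mult.assoc mult.left_commute[of x])
  qed simp
qed simp

text \<open>
  Pascal's rule is the recursion at a constant vector.
\<close>
lemma hsym_replicate:
  "n > 0 \<Longrightarrow> hsym m (replicate_mset n t) = real ((n + m - 1) choose m) * t ^ m"
proof (induction m arbitrary: n)
  case (Suc m)
  show ?case
  proof (cases n)
    case 0
    with Suc.prems show ?thesis by simp
  next
    case n: (Suc l)
    show ?thesis unfolding n
    proof (induction l)
      case 0
      show ?case using Suc.IH[of 1] by (simp add: hsym_Suc_add_mset)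
    next
      case (Suc l)
      then show ?case
        using Suc.IH Suc.prems \<open>\<And>n. 0 < n \<Longrightarrow> hsym m (replicate_mset n t) = _\<close>[of "Suc (Suc l)"]
        by (simp add: hsym_Suc_add_mset[of m t "add_mset t (replicate_mset l t)"] algebra_simps)
    qed
  qed
qed simp

section \<open>Smoothing and positivity in even degree\<close>

lemma sum_mset_lower:
  fixes c :: real
  assumes "\<forall>x\<in>#M. c \<le> x"
  shows "real (size M) * c \<le> sum_mset M"
  using assms by (induction M) (auto simp: algebra_simps)

lemma entry_below_mean:
  fixes c :: real
  assumes "sum_mset M = real (size M) * c" and "M \<noteq> replicate_mset (size M) c"
  shows "\<exists>a\<in>#M. a < c"
proof (rule ccontr)
  assume "\<not> ?thesis"
  then have le: "\<forall>x\<in>#M. c \<le> x" by auto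
  obtain b where b: "b \<in># M" "b \<noteq> c"
    using assms(2) by (metis set_mset_subset_singletonD singletonI subsetI)
  then obtain M' where M: "M = add_mset b M'" by (meson mset_add)
  have "real (size M') * c \<le> sum_mset M'"
    using le M by (intro sum_mset_lower) auto
  with assms(1) M b le show False
    by (auto simp: algebra_simps)
qed

lemma entry_above_mean:
  fixes c :: real
  assumes "sum_mset M = real (size M) * c" and "M \<noteq> replicate_mset (size M) c"
  shows "\<exists>b\<in>#M. c < b"
proof -
  have "sum_mset (image_mset uminus M) = - sum_mset M"
    by (induction M) simp_all
  moreover have "image_mset uminus M \<noteq> replicate_mset (size M) (- c)"
  proof
    assume "image_mset uminus M = replicate_mset (size M) (- c)"
    then have "image_mset uminus (image_mset uminus M) = image_mset uminus (replicate_mset (size M) (- c))"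
      by (simp only:)
    with assms(2) show False by (simp add: multiset.map_comp o_def)
  qed
  ultimately show ?thesis
    using entry_below_mean[of "image_mset uminus M" "- c"] assms(1) by auto
qed

text \<open>
  Schur convexity in the only case needed. If the group \<open>M\<close> is not constant, it has entries
  \<open>a < c < b\<close> around its mean \<open>c\<close>. The exchange \<open>(a, b) \<mapsto> (c, a + b - c)\<close> does not increase the
  value, and the new entry \<open>c\<close> may be moved to the untouched part \<open>Z\<close>: what remains of the group is
  smaller and still has mean \<open>c\<close>. This is why \<open>Z\<close> varies in the induction.
\<close>
lemma hsym_mean_le:
  assumes nonneg: "\<And>M. 0 \<le> hsym m M"
    and "sum_mset M = real (size M) * c"
  shows "hsym (Suc (Suc m)) (replicate_mset (size M) c + Z) \<le> hsym (Suc (Suc m)) (M + Z)"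
  using assms(2)
proof (induction "size M" arbitrary: M Z)
  case 0
  then show ?case by simp
next
  case (Suc s)
  show ?case
  proof (cases "M = replicate_mset (size M) c")
    case True
    then show ?thesis by (metis order_refl)
  next
    case False
    obtain a where a: "a \<in># M" "a < c"
      using entry_below_mean[OF Suc.prems False] by blast
    obtain b where b: "b \<in># M" "c < b"
      using entry_above_mean[OF Suc.prems False] by blast
    obtain M' where M: "M = add_mset a (add_mset b M')"
      using a b by (metis insert_DiffM insert_noteq_member less_asym)
    have "hsym (Suc (Suc m)) (replicate_mset (size M) c + Z)
        = hsym (Suc (Suc m)) (replicate_mset (size (add_mset (a + b - c) M')) c + add_mset c Z)"
      by (simp add: M)
    also have "\<dots> \<le> hsym (Suc (Suc m)) (add_mset (a + b - c) M' + add_mset c Z)"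
      using Suc.prems Suc.hyps(2) by (intro Suc.hyps(1)) (auto simp: M algebra_simps)
    also have "\<dots> \<le> hsym (Suc (Suc m)) (M + Z)"
    proof -
      have "0 \<le> (c - a) * (b - c) * hsym m (add_mset a (add_mset b (add_mset c (add_mset (a + b - c) (M' + Z)))))"
        using a b nonneg by (intro mult_nonneg_nonneg) auto
      then show ?thesis
        using hsym_exchange[of m a b "M' + Z" c] by (simp add: M add_mset_commute)
    qed
    finally show ?thesis .
  qed
qed

text \<open>
  Averaging all entries reduces to a constant vector, where an even power decides; averaging uses
  nonnegativity two degrees lower.
\<close>
lemma hsym_nonneg: "even m \<Longrightarrow> 0 \<le> hsym m M"
proof (induction m arbitrary: M rule: induct_nat_012)
  case (ge2 m)
  show ?case
  proof (cases "M = {#}")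
    case False
    define c where "c = sum_mset M / real (size M)"
    have "0 \<le> hsym (Suc (Suc m)) (replicate_mset (size M) c)"
      using False ge2.prems hsym_replicate[of "size M" "Suc (Suc m)" c]
      by (simp add: nonempty_has_size zero_le_even_power del: power_Suc binomial_Suc_Suc)
    also have "\<dots> \<le> hsym (Suc (Suc m)) M"
      using hsym_mean_le[of m M c "{#}"] ge2.IH(1) ge2.prems False by (simp add: c_def)
    finally show ?thesis .
  qed simp
qed simp_all

text \<open>
  Either the vector is constant, or a single exchange with the mean already decreases the value
  strictly, to something that is still nonnegative.
\<close>
lemma hsym_pos:
  assumes "even m" "x \<in># M" "x \<noteq> 0"
  shows "0 < hsym m M"
  using assms
proof (induction m arbitrary: M x rule: induct_nat_012)
  case (ge2 m)
  define c where "c = sum_mset M / real (size M)"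
  have "M \<noteq> {#}" using ge2.prems by auto
  then have c: "sum_mset M = real (size M) * c" by (simp add: c_def)
  show ?case
  proof (cases "M = replicate_mset (size M) c")
    case True
    then have "c \<noteq> 0" using ge2.prems by (metis in_replicate_mset)
    have "0 < real ((size M + Suc (Suc m) - 1) choose Suc (Suc m)) * c ^ Suc (Suc m)"
      using \<open>M \<noteq> {#}\<close> \<open>c \<noteq> 0\<close> ge2.prems(1)
      by (intro mult_pos_pos) (auto simp: nonempty_has_size zero_less_power_eq simp del: power_Suc binomial_Suc_Suc)
    with True \<open>M \<noteq> {#}\<close> hsym_replicate[of "size M" "Suc (Suc m)" c] show ?thesis
      by (metis nonempty_has_size)
  next
    case False
    obtain a where a: "a \<in># M" "a < c"
      using entry_below_mean[OF c False] by blast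
    obtain b where b: "b \<in># M" "c < b"
      using entry_above_mean[OF c False] by blast
    obtain M' where M: "M = add_mset a (add_mset b M')"
      using a b by (metis insert_DiffM insert_noteq_member less_asym)
    have "a \<noteq> 0 \<or> b \<noteq> 0" using a b by linarith
    then have "0 < hsym m (add_mset a (add_mset b (add_mset c (add_mset (a + b - c) M'))))"
      using ge2.IH(1)[of a "add_mset a (add_mset b (add_mset c (add_mset (a + b - c) M')))"]
        ge2.IH(1)[of b "add_mset a (add_mset b (add_mset c (add_mset (a + b - c) M')))"] ge2.prems(1)
      by auto
    then have "0 < (c - a) * (b - c) * hsym m (add_mset a (add_mset b (add_mset c (add_mset (a + b - c) M'))))"
      using a b by simp
    moreover have "0 \<le> hsym (Suc (Suc m)) (add_mset c (add_mset (a + b - c) M'))"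
      using ge2.prems(1) by (rule hsym_nonneg)
    ultimately show ?thesis
      using hsym_exchange[of m a b M' c] by (simp add: M)
  qed
qed simp_all

section \<open>Monotonicity in odd degree and the root\<close>

text \<open>
  The divided difference has even degree, and of two distinct numbers one is nonzero.
\<close>
lemma hsym_odd_strict_mono:
  assumes "odd m" "a < b"
  shows "hsym m (add_mset a M) < hsym m (add_mset b M)"
proof -
  obtain l where m: "m = Suc l" "even l" using assms(1) by (cases m) auto
  have "b \<noteq> 0 \<or> a \<noteq> 0" using assms(2) by auto
  then have "0 < hsym l (add_mset b (add_mset a M))"
    using hsym_pos[OF m(2), of a] hsym_pos[OF m(2), of b] by auto
  then have "0 < (b - a) * hsym l (add_mset b (add_mset a M))"
    using assms(2) by simp
  with hsym_diff[of l b M a] m show ?thesis by simp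
qed

lemma hsym_odd_replicate_mono:
  assumes "odd m" "a \<le> b"
  shows "hsym m (replicate_mset n a + M) \<le> hsym m (replicate_mset n b + M)"
proof (induction n arbitrary: M)
  case (Suc n)
  have "hsym m (replicate_mset (Suc n) a + M) = hsym m (replicate_mset n a + add_mset a M)"
    by simp
  also have "\<dots> \<le> hsym m (replicate_mset n b + add_mset a M)"
    by (rule Suc)
  also have "\<dots> \<le> hsym m (replicate_mset (Suc n) b + M)"
    using hsym_odd_strict_mono[OF assms(1), of a b "replicate_mset n b + M"] assms(2)
    by (cases "a = b") auto
  finally show ?case .
qed simp

lemma hsym_odd_replicate_strict_mono:
  assumes "odd m" "a < b" "n > 0"
  shows "hsym m (replicate_mset n a + M) < hsym m (replicate_mset n b + M)"
proof -
  obtain l where n: "n = Suc l" using assms(3) by (cases n) auto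
  have "hsym m (replicate_mset n a + M) \<le> hsym m (replicate_mset l b + add_mset a M)"
    using hsym_odd_replicate_mono[OF assms(1), of a b l "add_mset a M"] assms(2) by (simp add: n)
  also have "\<dots> < hsym m (replicate_mset n b + M)"
    using hsym_odd_strict_mono[OF assms(1,2), of "replicate_mset l b + M"] by (simp add: n)
  finally show ?thesis .
qed

lemma continuous_on_hsym_replicate:
  "continuous_on A (\<lambda>t. hsym m (replicate_mset n t + M))"
proof (induction m arbitrary: n)
  case (Suc m)
  show ?case
  proof (induction n)
    case (Suc n)
    show ?case
      using Suc \<open>\<And>n. continuous_on A (\<lambda>t. hsym m (replicate_mset n t + M))\<close>[of "Suc n"]
      by (simp add: hsym_Suc_add_mset continuous_intros)
  qed simp
qed simp

text \<open>
  The pair \<open>1, -1\<close> contributes the factor \<open>1 / (1 - T\<^sup>2)\<close> to the generating function, so the value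
  is the sum of \<open>h\<^sub>j(-1,\<dots>,-1) < 0\<close> over the odd \<open>j \<le> m\<close>. It bounds the root from below.
\<close>
lemma hsym_odd_antipodal_neg:
  assumes "odd m" "n > 0"
  shows "hsym m (add_mset 1 (add_mset (-1) (replicate_mset n (-1)))) < 0"
proof -
  have neg: "hsym m (replicate_mset n (-1)) < 0" if "odd m" for m
    using that assms(2) by (auto simp: hsym_replicate)
  have rec: "hsym (Suc (Suc m)) (add_mset 1 (add_mset (-1) M))
      = hsym (Suc (Suc m)) M + hsym m (add_mset 1 (add_mset (-1) M))" for m M
    using hsym_Suc_add_mset[of "Suc m" 1 "add_mset (-1) M"]
      hsym_Suc_add_mset[of "Suc m" "-1" M] hsym_Suc_add_mset[of m 1 "add_mset (-1) M"]
    by simp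
  show ?thesis using assms(1)
  proof (induction m rule: induct_nat_012)
    case 1
    show ?case using neg[of 1] by (simp add: hsym_Suc_add_mset)
  next
    case (ge2 m)
    then show ?case using neg[of "Suc (Suc m)"] by (simp add: rec)
  qed simp
qed

lemma is_chs_root_iff:
  "is_chs_root n k t \<longleftrightarrow> -1 < t \<and> t < 0 \<and> hsym (2 * k - 1) (replicate_mset n t + {#1#}) = 0"
  by (simp add: is_chs_root_def chs_eq_hsym)

text \<open>
  The function \<open>t \<mapsto> h\<^sub>2\<^sub>k\<^sub>-\<^sub>1(t,\<dots>,t,1)\<close> is strictly increasing, negative at \<open>-1\<close> and equal to \<open>1\<close>
  at \<open>0\<close>. The condition \<open>n \<ge> 2\<close> matters at \<open>-1\<close>: for \<open>n = 1\<close> the root is \<open>-1\<close> itself.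
\<close>
lemma ex1_chs_root:
  assumes "n \<ge> 2" "k > 0"
  shows "\<exists>!t. is_chs_root n k t"
proof -
  let ?f = "\<lambda>t. hsym (2 * k - 1) (replicate_mset n t + {#1#})"
  have odd: "odd (2 * k - 1)" using assms(2) by simp
  obtain l where n: "n = Suc l" "l > 0" using assms(1) by (cases n) auto
  have lo: "?f (-1) < 0"
    using hsym_odd_antipodal_neg[OF odd n(2)] by (simp add: n add_mset_commute)
  have "?f 0 = 1"
  proof -
    have "hsym (2 * k - 1) (replicate_mset n 0 + M) = hsym (2 * k - 1) M" for M
    proof -
      obtain j where "2 * k - 1 = Suc j" using odd by (metis odd_pos gr0_conv_Suc)
      then show ?thesis by (induction n) (simp_all add: hsym_Suc_add_mset)
    qed
    from this[of "{#1#}"] show ?thesis using hsym_replicate[of 1 "2 * k - 1" 1] by simp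
  qed
  then obtain t where t: "-1 \<le> t" "t \<le> 0" "?f t = 0"
    using IVT'[of ?f "-1" 0 0] lo continuous_on_hsym_replicate by fastforce
  have "t \<noteq> -1" "t \<noteq> 0" using t lo \<open>?f 0 = 1\<close> by auto
  with t have "is_chs_root n k t" by (simp add: is_chs_root_iff)
  moreover have "s = t" if "is_chs_root n k s" for s
    using that t hsym_odd_replicate_strict_mono[OF odd, of s t n "{#1#}"]
      hsym_odd_replicate_strict_mono[OF odd, of t s n "{#1#}"] n
    by (auto simp: is_chs_root_iff) (metis less_irrefl linorder_neqE_linordered_idom)
  ultimately show ?thesis by blast
qed

section \<open>The minimum with one entry fixed to one\<close>

text \<open>
  Write \<open>n = l + 1\<close>. By the recursion, \<open>h\<^sub>m\<^sub>+\<^sub>1(t,\<dots>,t,1)\<close> with \<open>n\<close> copies of \<open>t\<close> differs from the same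
  expression without one \<open>t\<close>, and from the one without the \<open>1\<close>, by multiples of
  \<open>h\<^sub>m(t,\<dots>,t,1) = 0\<close>. So all three agree, and the last is the value at a constant vector.
\<close>
lemma hsym_at_root:
  assumes "hsym m (replicate_mset (Suc l) t + {#1#}) = 0"
  shows "hsym (Suc m) (replicate_mset l t + {#1#}) = real ((l + Suc m) choose Suc m) * t ^ Suc m"
proof -
  have "hsym (Suc m) (replicate_mset (Suc l) t + {#1#}) = hsym (Suc m) (replicate_mset l t + {#1#})"
    using assms hsym_Suc_add_mset[of m t "replicate_mset l t + {#1#}"] by (simp add: add_mset_commute)
  moreover have "hsym (Suc m) (add_mset 1 (replicate_mset (Suc l) t)) = hsym (Suc m) (replicate_mset (Suc l) t)"
    using assms hsym_Suc_add_mset[of m 1 "replicate_mset (Suc l) t"] by (simp add: add_mset_commute)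
  ultimately show ?thesis
    using hsym_replicate[of "Suc l" "Suc m" t] by simp
qed

text \<open>
  Change the entries from \<open>t\<close> to \<open>s\<close> one at a time. Each change contributes \<open>s - t\<close> times a value of
  \<open>h\<^sub>m\<close> at a mixture of entries \<open>s\<close> and \<open>t\<close>; since \<open>h\<^sub>m\<close> is increasing and vanishes when all of them
  equal \<open>t\<close>, that value has the sign of \<open>s - t\<close>.
\<close>
lemma hsym_replicate_min:
  assumes "odd m" "hsym m (replicate_mset (Suc l) t + Z) = 0"
  shows "hsym (Suc m) (replicate_mset l t + Z) \<le> hsym (Suc m) (replicate_mset l s + Z)"
proof -
  have "hsym (Suc m) (replicate_mset (i + j) t + Z)
      \<le> hsym (Suc m) (replicate_mset i s + replicate_mset j t + Z)" if "i + j = l" for i j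
    using that
  proof (induction i arbitrary: j)
    case (Suc i)
    let ?M = "replicate_mset i s + replicate_mset j t + Z"
    let ?g = "\<lambda>u v. hsym m (replicate_mset i u + add_mset v (replicate_mset (Suc j) t + Z))"
    have zero: "?g t t = 0"
    proof -
      have "replicate_mset i t + add_mset t (replicate_mset (Suc j) t + Z) = replicate_mset (Suc l) t + Z"
        using Suc.prems by (auto simp: multiset_eq_iff)
      with assms(2) show ?thesis by (simp only:)
    qed
    have "0 \<le> (s - t) * ?g s s"
    proof (cases "t \<le> s")
      case True
      have "0 \<le> ?g s s"
        using hsym_odd_replicate_mono[OF assms(1) True, of "Suc i" "replicate_mset (Suc j) t + Z"] zero
        by (simp add: add_mset_commute)
      with True show ?thesis by simp
    next
      case False
      then have "s \<le> t" by simp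
      then have "?g s s \<le> 0"
        using hsym_odd_replicate_mono[OF assms(1) \<open>s \<le> t\<close>, of "Suc i" "replicate_mset (Suc j) t + Z"] zero
        by (simp add: add_mset_commute)
      with \<open>s \<le> t\<close> show ?thesis by (simp add: mult_nonpos_nonpos)
    qed
    then have "hsym (Suc m) (add_mset t ?M) \<le> hsym (Suc m) (add_mset s ?M)"
      using hsym_diff[of m s ?M t] by (simp add: add_mset_commute add.assoc)
    with Suc.IH[of "Suc j"] Suc.prems show ?case by auto
  qed simp
  from this[of l 0] show ?thesis by simp
qed

lemma hsym_ge_at_root:
  assumes "odd m" "hsym m (replicate_mset (Suc l) t + {#1#}) = 0" "size M = l"
  shows "real ((l + Suc m) choose Suc m) * t ^ Suc m \<le> hsym (Suc m) (add_mset 1 M)"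
proof -
  obtain p where m: "m = Suc p" "even p" using assms(1) by (cases m) auto
  define c where "c = sum_mset M / real (size M)"
  have c: "sum_mset M = real (size M) * c" by (cases "M = {#}") (auto simp: c_def)
  have "real ((l + Suc m) choose Suc m) * t ^ Suc m = hsym (Suc m) (replicate_mset l t + {#1#})"
    using hsym_at_root[OF assms(2)] by simp
  also have "\<dots> \<le> hsym (Suc m) (replicate_mset l c + {#1#})"
    by (rule hsym_replicate_min[OF assms(1,2)])
  also have "\<dots> \<le> hsym (Suc m) (M + {#1#})"
    using hsym_mean_le[OF hsym_nonneg c, of p "{#1#}"] m assms(3) by simp
  finally show ?thesis by simp
qed

section \<open>Bounds in terms of the maximum norm\<close>

lemma hsym_bounds_of_nonneg:
  assumes "\<forall>x\<in>#M. 0 \<le> x \<and> x \<le> s"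
  shows "0 \<le> hsym m M \<and> hsym m M \<le> hsym m (replicate_mset (size M) s)"
  using assms
proof (induction m arbitrary: M)
  case (Suc m)
  note IH = Suc.IH
  show ?case using Suc.prems
  proof (induction M)
    case (add x M)
    have "x * hsym m (add_mset x M) \<le> s * hsym m (replicate_mset (Suc (size M)) s)"
      using IH[of "add_mset x M"] add.prems by (intro mult_mono) auto
    with add IH[of "add_mset x M"] show ?case by (auto simp: hsym_Suc_add_mset)
  qed simp
qed simp

lemma linf_norm_nonneg: "xs \<noteq> [] \<Longrightarrow> 0 \<le> linf_norm xs"
  unfolding linf_norm_def by (subst Max_ge_iff) (auto simp: neq_Nil_conv)

lemma chs_scale: "chs m (map ((*) c) xs) = c ^ m * chs m xs"
  by (simp add: chs_eq_hsym hsym_scale)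

text \<open>
  Divide by an entry \<open>u\<close> of largest modulus. The degree is even, so homogeneity gives back the factor
  \<open>u\<^sup>2\<^sup>k = \<parallel>x\<parallel>\<^sub>\<infinity>\<^sup>2\<^sup>k\<close> whatever the sign of \<open>u\<close>.
\<close>
lemma chs_ge_linf_norm:
  assumes root: "is_chs_root n k t" and n: "n > 0" and k: "k > 0" and len: "length xs = n"
  shows "real ((n + 2 * k - 1) choose (2 * k)) * t ^ (2 * k) * linf_norm xs ^ (2 * k) \<le> chs (2 * k) xs"
proof (cases "linf_norm xs = 0")
  case True
  then show ?thesis
    using k hsym_nonneg[of "2 * k" "mset xs"] by (simp add: chs_eq_hsym power_0_left)
next
  case False
  have "linf_norm xs \<in> abs ` set xs"
    unfolding linf_norm_def using n len by (intro Max_in) auto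
  then obtain u where u: "u \<in> set xs" "\<bar>u\<bar> = linf_norm xs" by auto
  have "u \<noteq> 0" using u(2) False by auto
  obtain M where M: "mset xs = add_mset u M"
    using u(1) by (metis mset_add set_mset_mset)
  define N where "N = image_mset ((*) (1 / u)) M"
  have M_eq: "mset xs = image_mset ((*) u) (add_mset 1 N)"
    using \<open>u \<noteq> 0\<close> by (simp add: M N_def multiset.map_comp o_def)
  have "size N = n - 1"
    using len M by (metis N_def size_image_mset size_mset size_add_mset diff_Suc_1)
  then have "real ((n - 1 + Suc (2 * k - 1)) choose Suc (2 * k - 1)) * t ^ Suc (2 * k - 1)
      \<le> hsym (Suc (2 * k - 1)) (add_mset 1 N)"
    using root n k by (intro hsym_ge_at_root) (auto simp: is_chs_root_iff)
  then have "real ((n + 2 * k - 1) choose (2 * k)) * t ^ (2 * k) \<le> hsym (2 * k) (add_mset 1 N)"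
    using n k by simp
  then have "u ^ (2 * k) * (real ((n + 2 * k - 1) choose (2 * k)) * t ^ (2 * k)) \<le> chs (2 * k) xs"
    unfolding chs_eq_hsym M_eq hsym_scale by (intro mult_left_mono zero_le_even_power) auto
  moreover have "u ^ (2 * k) = linf_norm xs ^ (2 * k)"
    using u(2) by (metis power_even_abs even_mult_iff even_numeral)
  ultimately show ?thesis by (simp add: mult_ac)
qed

lemma chs_le_linf_norm:
  assumes "xs \<noteq> []" "\<forall>x\<in>set xs. 0 \<le> x"
  shows "chs m xs \<le> real ((length xs + m - 1) choose m) * linf_norm xs ^ m"
proof -
  have "x \<le> linf_norm xs" if "x \<in> set xs" for x
    unfolding linf_norm_def using that by (intro order_trans[OF abs_ge_self Max_ge]) auto
  then show ?thesis
    using hsym_bounds_of_nonneg[of "mset xs" "linf_norm xs" m] assms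
    by (simp add: chs_eq_hsym hsym_replicate)
qed

lemma chs_at_root:
  assumes "is_chs_root n k t" "n > 0" "k > 0"
  shows "chs (2 * k) (1 # replicate (n - 1) t) = real ((n + 2 * k - 1) choose (2 * k)) * t ^ (2 * k)"
proof -
  have "hsym (Suc (2 * k - 1)) (replicate_mset (n - 1) t + {#1#})
      = real ((n - 1 + Suc (2 * k - 1)) choose Suc (2 * k - 1)) * t ^ Suc (2 * k - 1)"
    using assms by (intro hsym_at_root) (simp add: is_chs_root_iff)
  then show ?thesis using assms(2,3) by (simp add: chs_eq_hsym)
qed

lemma root_bound_eq:
  assumes "k > 0" "0 \<le> L"
  shows "root (2 * k) (real ((n + 2 * k - 1) choose (2 * k)) * t ^ (2 * k) * L ^ (2 * k))
    = chs_const n k * \<bar>t\<bar> * L"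
proof -
  have "root (2 * k) (t ^ (2 * k)) = \<bar>t\<bar>"
    using assms(1) real_root_power_cancel[of "2 * k" "\<bar>t\<bar>"] by (simp add: power_even_abs)
  then show ?thesis
    using assms by (simp add: real_root_mult chs_const_def real_root_power_cancel)
qed

section \<open>Singular values and the operator norm\<close>

text \<open>
  In the Leibniz expansion only the identity permutation yields a product of degree \<open>n\<close>: every other
  permutation picks a constant off-diagonal entry.
\<close>
lemma degree_charpoly:
  fixes M :: "complex^'n^'n"
  shows "degree (charpoly M) = CARD('n)"
proof -
  let ?P = "mat [:0, 1:] - map_matrix (\<lambda>c. [:c:]) M"
  let ?S = "{p. p permutes (UNIV :: 'n set)}"
  let ?f = "\<lambda>p. of_int (sign p) * (\<Prod>i\<in>UNIV. ?P $ i $ p i)"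
  have entry: "?P $ i $ j = (if i = j then [:- (M $ i $ j), 1:] else [:- (M $ i $ j):])" for i j
    by (simp add: mat_def)
  have id: "degree (?f id) = CARD('n)"
    by (simp add: entry degree_prod_eq_sum_degree del: minus_apply vector_minus_component)
  have less: "degree (?f p) < CARD('n)" if "p \<noteq> id" for p
  proof -
    from that obtain i where i: "p i \<noteq> i" by (auto simp: fun_eq_iff)
    have "degree (?f p) \<le> degree (\<Prod>i\<in>UNIV. ?P $ i $ p i)"
      by (cases p rule: sign_cases) simp_all
    also have "\<dots> \<le> (\<Sum>i\<in>UNIV. degree (?P $ i $ p i))"
      by (rule degree_prod_sum_le[unfolded o_def]) simp
    also have "\<dots> < (\<Sum>i\<in>(UNIV::'n set). 1)"
      using i by (intro sum_strict_mono_ex1) (auto simp: entry intro!: exI[of _ i] simp del: vector_minus_component)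
    finally show ?thesis by simp
  qed
  have "charpoly M = ?f id + (\<Sum>p\<in>?S - {id}. ?f p)"
    unfolding charpoly_def det_def by (rule sum.remove) (auto intro: permutes_id finite_permutations)
  moreover have "degree (\<Sum>p\<in>?S - {id}. ?f p) < CARD('n)"
    by (rule degree_sum_less) (use less in blast, simp)
  ultimately show ?thesis
    using id by (simp add: degree_add_eq_left)
qed

lemma poly_charpoly: "poly (charpoly M) z = det (mat z - M)"
proof -
  have entry: "poly ((mat [:0, 1:] - map_matrix (\<lambda>c. [:c:]) M) $ i $ j) z = (mat z - M) $ i $ j" for i j
    by (simp add: mat_def)
  show ?thesis
    unfolding charpoly_def det_def poly_sum poly_mult poly_prod entry by (simp add: poly_of_int)
qed

lemma poly_charpoly_eq_0_iff:
  fixes M :: "complex^'n^'n"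
  shows "poly (charpoly M) z = 0 \<longleftrightarrow> (\<exists>v. v \<noteq> 0 \<and> M *v v = z *s v)"
proof -
  have "poly (charpoly M) z = 0 \<longleftrightarrow> \<not> invertible (mat z - M)"
    by (simp add: poly_charpoly invertible_det_nz)
  also have "\<dots> \<longleftrightarrow> (\<exists>v. v \<noteq> 0 \<and> (mat z - M) *v v = 0)"
    by (auto simp: invertible_left_inverse matrix_left_invertible_ker)
  also have "\<dots> \<longleftrightarrow> (\<exists>v. v \<noteq> 0 \<and> M *v v = z *s v)"
  proof -
    have "mat z *v v = z *s v" for v :: "complex^'n"
      by (simp add: mat_def matrix_vector_mult_def vec_eq_iff if_distrib[of "\<lambda>x. x * _"] cong: if_cong)
    then show ?thesis by (auto simp: matrix_vector_mult_diff_rdistrib)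
  qed
  finally show ?thesis .
qed

text \<open>
  The real inner product on \<open>complex^'n\<close> is the real part of the Hermitian one; that suffices for
  working with adjoints here.
\<close>
lemma inner_conj_transpose:
  "inner (conj_transpose A *v w) v = inner w (A *v v)"
proof -
  have "inner (conj_transpose A *v w) v = (\<Sum>j\<in>UNIV. \<Sum>i\<in>UNIV. inner (cnj (A $ i $ j) * w $ i) (v $ j))"
    by (simp add: inner_vec_def matrix_vector_mult_def conj_transpose_def transpose_def inner_sum_left)
  also have "\<dots> = (\<Sum>i\<in>UNIV. \<Sum>j\<in>UNIV. inner (cnj (A $ i $ j) * w $ i) (v $ j))"
    by (rule sum.swap)
  also have "\<dots> = (\<Sum>i\<in>UNIV. \<Sum>j\<in>UNIV. inner (w $ i) (A $ i $ j * v $ j))"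
    by (intro sum.cong refl) (simp add: inner_complex_def algebra_simps)
  also have "\<dots> = inner w (A *v v)"
    by (simp add: inner_vec_def matrix_vector_mult_def inner_sum_right)
  finally show ?thesis .
qed

lemma bounded_linear_matrix_complex: "bounded_linear (\<lambda>v. (A :: complex^'n^'m) *v v)"
proof -
  have "linear (\<lambda>v. A *v v)"
  proof (rule linearI)
    show "A *v (r *\<^sub>R v) = r *\<^sub>R (A *v v)" for r v
      by (simp add: matrix_vector_mult_def vec_eq_iff scaleR_sum_right)
  qed (rule matrix_vector_right_distrib)
  then show ?thesis by (simp add: linear_conv_bounded_linear)
qed

lemma norm_matrix_le_op_norm: "norm (A *v v) \<le> op_norm A * norm v"
  unfolding op_norm_def by (rule onorm[OF bounded_linear_matrix_complex])

lemma norm_conj_transpose_le: "norm (conj_transpose A *v w) \<le> op_norm A * norm w"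
proof (cases "conj_transpose A *v w = 0")
  case True
  then show ?thesis
    by (simp add: op_norm_def onorm_pos_le[OF bounded_linear_matrix_complex])
next
  case False
  let ?u = "conj_transpose A *v w"
  have "norm ?u * norm ?u = inner w (A *v ?u)"
    by (simp flip: inner_conj_transpose add: dot_square_norm power2_eq_square)
  also have "\<dots> \<le> norm w * norm (A *v ?u)" by (rule norm_cauchy_schwarz)
  also have "\<dots> \<le> norm w * (op_norm A * norm ?u)"
    by (intro mult_left_mono norm_matrix_le_op_norm) simp
  finally have "norm ?u * norm ?u \<le> (op_norm A * norm w) * norm ?u" by (simp add: mult_ac)
  with False show ?thesis by simp
qed

text \<open>
  The unit sphere is compact.
\<close>
lemma op_norm_attained: "\<exists>v. norm v = 1 \<and> norm (A *v v) = op_norm A"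
proof -
  let ?g = "\<lambda>v. norm (A *v v)"
  have "continuous_on (sphere 0 1) ?g"
    by (intro continuous_on_norm linear_continuous_on bounded_linear_matrix_complex)
  moreover have "sphere 0 1 \<noteq> ({} :: (complex^'b) set)" by simp
  ultimately obtain v where v: "norm v = 1" "\<And>w. norm w = 1 \<Longrightarrow> ?g w \<le> ?g v"
    using continuous_attains_sup[of "sphere 0 1" ?g] by (auto simp: dist_norm)
  have "?g w \<le> ?g v * norm w" for w
  proof (cases "w = 0")
    case False
    interpret bounded_linear "\<lambda>v. A *v v" by (rule bounded_linear_matrix_complex)
    have "?g (inverse (norm w) *\<^sub>R w) \<le> ?g v" using False by (intro v(2)) simp
    then show ?thesis using False by (simp add: scaleR field_simps)
  qed simp
  then have "op_norm A \<le> ?g v" unfolding op_norm_def by (rule onorm_le)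
  with norm_matrix_le_op_norm[of A v] v(1) show ?thesis by (intro exI[of _ v]) auto
qed

text \<open>
  Equality in the Cauchy-Schwarz inequality: \<open>b = A\<^sup>*A v\<close> has norm at most \<open>\<sigma>\<^sup>2\<close> and inner product
  \<open>\<sigma>\<^sup>2\<close> with the unit vector \<open>v\<close>, where \<open>\<sigma>\<close> is the operator norm, so
  \<open>\<parallel>b - \<sigma>\<^sup>2 v\<parallel>\<^sup>2 = \<parallel>b\<parallel>\<^sup>2 - \<sigma>\<^sup>4 \<le> 0\<close>.
\<close>
lemma max_vector_eigenvector:
  assumes "norm v = 1" "norm (A *v v) = op_norm A"
  shows "(conj_transpose A ** A) *v v = (op_norm A)\<^sup>2 *\<^sub>R v"
proof -
  let ?s = "op_norm A" and ?b = "conj_transpose A *v (A *v v)"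
  have b: "norm ?b \<le> ?s\<^sup>2"
    using norm_conj_transpose_le[of A "A *v v"] assms by (simp add: power2_eq_square)
  have ip: "inner ?b v = ?s\<^sup>2"
    using assms by (simp add: inner_conj_transpose dot_square_norm)
  have "(norm (?b - ?s\<^sup>2 *\<^sub>R v))\<^sup>2 = (norm ?b)\<^sup>2 - 2 * (?s\<^sup>2 * inner ?b v) + ?s\<^sup>2 * (?s\<^sup>2 * (norm v)\<^sup>2)"
    by (simp only: power2_norm_eq_inner inner_diff_left inner_diff_right inner_scaleR_left
        inner_scaleR_right inner_commute[of v ?b]) (simp add: algebra_simps)
  also have "\<dots> = (norm ?b)\<^sup>2 - (?s\<^sup>2)\<^sup>2"
    using assms(1) ip by (simp add: power2_eq_square)
  also have "\<dots> \<le> 0" using power_mono[OF b, of 2] by simp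
  finally show ?thesis by (simp flip: matrix_vector_mul_assoc)
qed

lemma length_singular_values: "length (singular_values (A :: complex^'n^'n)) = CARD('n)"
  by (simp add: singular_values_def size_proots_complex degree_charpoly flip: size_mset)

lemma set_singular_values:
  fixes A :: "complex^'n^'n"
  shows "set (singular_values A)
    = {sqrt (Re z) | z v. v \<noteq> 0 \<and> (conj_transpose A ** A) *v v = z *s v}"
proof -
  have "charpoly (conj_transpose A ** A) \<noteq> 0"
    using degree_charpoly[of "conj_transpose A ** A"] by force
  then show ?thesis
    by (auto simp: singular_values_def poly_charpoly_eq_0_iff)
qed

text \<open>
  For an eigenvector \<open>v\<close> of \<open>A\<^sup>*A\<close> with eigenvalue \<open>z\<close>, the real inner product of \<open>A\<^sup>*A v\<close> and \<open>v\<close> gives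
  \<open>\<parallel>A v\<parallel>\<^sup>2 = Re z \<parallel>v\<parallel>\<^sup>2\<close>.
\<close>
lemma singular_value_stretch:
  assumes "s \<in> set (singular_values A)"
  shows "0 \<le> s \<and> (\<exists>v. v \<noteq> 0 \<and> norm (A *v v) = s * norm v)"
proof -
  obtain z v where s: "s = sqrt (Re z)" and v: "v \<noteq> 0" "(conj_transpose A ** A) *v v = z *s v"
    using assms by (auto simp: set_singular_values)
  have "(norm (A *v v))\<^sup>2 = inner (z *s v) v"
    by (simp add: power2_norm_eq_inner inner_conj_transpose flip: v(2) matrix_vector_mul_assoc)
  also have "\<dots> = Re z * (norm v)\<^sup>2"
    by (simp add: power2_norm_eq_inner inner_vec_def inner_complex_def sum_distrib_left algebra_simps)
  finally have eq: "(norm (A *v v))\<^sup>2 = Re z * (norm v)\<^sup>2" .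
  then have "0 \<le> Re z"
    using v(1) by (metis mult_less_0_iff not_le zero_le_power2 zero_less_norm_iff zero_less_power)
  then have "norm (A *v v) = s * norm v"
    using arg_cong[OF eq, of sqrt] by (simp add: s real_sqrt_mult)
  with v \<open>0 \<le> Re z\<close> s show ?thesis by auto
qed

text \<open>
  No singular value exceeds the operator norm, as each is the stretching factor of some vector;
  a unit vector of maximal stretching is an eigenvector and shows that the operator norm is one of
  them.
\<close>
lemma linf_norm_singular_values: "linf_norm (singular_values A) = op_norm A"
  unfolding linf_norm_def
proof (rule Max_eqI)
  fix y assume "y \<in> abs ` set (singular_values A)"
  then obtain s v where "y = s" and v: "v \<noteq> 0" "norm (A *v v) = s * norm v"
    using singular_value_stretch by fastforce
  then have "y * norm v \<le> op_norm A * norm v"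
    using norm_matrix_le_op_norm[of A v] by simp
  with v(1) show "y \<le> op_norm A" by simp
next
  obtain v where v: "norm v = 1" "norm (A *v v) = op_norm A"
    using op_norm_attained by blast
  have "(conj_transpose A ** A) *v v = of_real ((op_norm A)\<^sup>2) *s v"
    using max_vector_eigenvector[OF v] by (simp add: vec_eq_iff scaleR_conv_of_real[where 'a = complex])
  moreover have "v \<noteq> 0" using v(1) by auto
  moreover have "op_norm A \<ge> 0" by (simp flip: v(2))
  ultimately have "op_norm A \<in> set (singular_values A)"
    unfolding set_singular_values
    by (intro CollectI exI[of _ "of_real ((op_norm A)\<^sup>2)"] exI[of _ v]) simp
  then show "op_norm A \<in> abs ` set (singular_values A)"
    using \<open>op_norm A \<ge> 0\<close> by force
qed simp

lemma op_norm_one: "op_norm (mat 1 :: complex^'n^'n) = 1"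
  using op_norm_attained[of "mat 1 :: complex^'n^'n"] by auto

lemma singular_values_one: "singular_values (mat 1 :: complex^'n^'n) = replicate (CARD('n)) 1"
  by (rule replicate_eqI) (auto simp: length_singular_values dest: singular_value_stretch)

lemma op_norm_pos: "A \<noteq> 0 \<Longrightarrow> 0 < op_norm A"
  by (metis (no_types) matrix_eq matrix_vector_mult_0 mult_zero_left norm_le_zero_iff norm_matrix_le_op_norm
      op_norm_def onorm_pos_le bounded_linear_matrix_complex order_le_less)

section \<open>The norm inequality\<close>

theorem corollary6p4:
  fixes A :: "complex^'n^'n" and n d k :: nat
  assumes "n = CARD('n)" and "n \<ge> 2" and "d = 2 * k" and "d > 0"
  shows "(\<exists>!t. is_chs_root n k t) \<and>
    chs_const n k * \<bar>chs_root n k\<bar> * op_norm A \<le> chs_norm d A \<and>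
    chs_norm d A \<le> chs_const n k * op_norm A \<and>
    (\<forall>c. (\<forall>x. length x = n \<longrightarrow> c * linf_norm x \<le> root d (chs d x))
          \<longleftrightarrow> c \<le> chs_const n k * \<bar>chs_root n k\<bar>) \<and>
    (\<forall>c. (\<forall>B :: complex^'n^'n. chs_norm d B \<le> c * op_norm B) \<longrightarrow> chs_const n k \<le> c) \<and>
    (A \<noteq> 0 \<longrightarrow> chs_norm d A = chs_const n k * \<bar>chs_root n k\<bar> * op_norm A \<longrightarrow>
      is_arg_min (chs d) (\<lambda>x. x \<in> linf_sphere n) (map (\<lambda>s. s / op_norm A) (singular_values A)))"
proof -
  define t where "t = chs_root n k"
  define b where "b = real ((n + 2 * k - 1) choose (2 * k))"
  have k: "k > 0" and n: "n > 0" and d: "d = 2 * k" using assms by auto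
  have ex1: "\<exists>!t. is_chs_root n k t" using ex1_chs_root assms(2) k by blast
  then have t: "is_chs_root n k t"
    unfolding t_def chs_root_def by (rule theI')
  have t_bounds: "\<bar>t\<bar> \<le> 1" using t by (simp add: is_chs_root_iff)
  have len: "length (singular_values B) = n" for B :: "complex^'n^'n"
    by (simp add: length_singular_values assms(1))
  have lower: "b * t ^ d * linf_norm x ^ d \<le> chs d x" if "length x = n" for x
    using chs_ge_linf_norm[OF t n k that] by (simp add: d b_def)
  have root_lower: "chs_const n k * \<bar>t\<bar> * linf_norm x \<le> root d (chs d x)" if "length x = n" for x
  proof -
    have "0 \<le> linf_norm x" using that n by (intro linf_norm_nonneg) auto
    then have "chs_const n k * \<bar>t\<bar> * linf_norm x = root d (b * t ^ d * linf_norm x ^ d)"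
      using root_bound_eq[OF k] by (simp add: d b_def)
    then show ?thesis using lower[OF that] k d by simp
  qed
  have upper: "chs_norm d A \<le> chs_const n k * op_norm A"
  proof -
    have ne: "singular_values A \<noteq> []" using len[of A] n by auto
    have "chs d (singular_values A) \<le> b * op_norm A ^ d"
      using chs_le_linf_norm[OF ne, of d] singular_value_stretch[of _ A]
      by (simp add: len linf_norm_singular_values b_def d)
    then have "chs_norm d A \<le> root d (b * 1 ^ d * op_norm A ^ d)"
      using k d by (simp add: chs_norm_def)
    also have "\<dots> = chs_const n k * \<bar>1\<bar> * op_norm A"
      using root_bound_eq[OF k, of "op_norm A" n 1] linf_norm_nonneg[OF ne]
      by (simp add: linf_norm_singular_values b_def d)
    finally show ?thesis by simp
  qed
  have lower_optimal: "(\<forall>x. length x = n \<longrightarrow> c * linf_norm x \<le> root d (chs d x))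
      \<longleftrightarrow> c \<le> chs_const n k * \<bar>t\<bar>" for c
  proof
    \<comment> \<open>A minimiser; its maximum norm is \<open>1\<close> because \<open>\<bar>t\<bar> \<le> 1\<close>.\<close>
    let ?x = "1 # replicate (n - 1) t"
    assume "\<forall>x. length x = n \<longrightarrow> c * linf_norm x \<le> root d (chs d x)"
    then have "c * linf_norm ?x \<le> root d (chs d ?x)" using n by simp
    moreover have "linf_norm ?x = 1"
      unfolding linf_norm_def using t_bounds by (intro Max_eqI) auto
    moreover have "root d (chs d ?x) = chs_const n k * \<bar>t\<bar>"
      using chs_at_root[OF t n k] root_bound_eq[OF k, of 1 n t] by (simp add: d)
    ultimately show "c \<le> chs_const n k * \<bar>t\<bar>" by simp
  next
    assume c: "c \<le> chs_const n k * \<bar>t\<bar>"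
    show "\<forall>x. length x = n \<longrightarrow> c * linf_norm x \<le> root d (chs d x)"
    proof (intro allI impI)
      fix x :: "real list" assume x: "length x = n"
      have "c * linf_norm x \<le> chs_const n k * \<bar>t\<bar> * linf_norm x"
        using c x n by (intro mult_right_mono linf_norm_nonneg) auto
      also have "\<dots> \<le> root d (chs d x)" by (rule root_lower[OF x])
      finally show "c * linf_norm x \<le> root d (chs d x)" .
    qed
  qed
  have upper_optimal: "chs_const n k \<le> c"
    if "\<forall>B :: complex^'n^'n. chs_norm d B \<le> c * op_norm B" for c
  proof -
    have "chs_norm d (mat 1 :: complex^'n^'n) \<le> c"
      using that[rule_format, of "mat 1"] by (simp add: op_norm_one)
    then show ?thesis
      using n by (simp add: chs_norm_def singular_values_one chs_eq_hsym hsym_replicate chs_const_def d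
          flip: assms(1))
  qed
  have arg_min: "is_arg_min (chs d) (\<lambda>x. x \<in> linf_sphere n) (map (\<lambda>s. s / op_norm A) (singular_values A))"
    if "A \<noteq> 0" and eq: "chs_norm d A = chs_const n k * \<bar>t\<bar> * op_norm A"
  proof -
    let ?s = "singular_values A" and ?y = "map (\<lambda>s. s / op_norm A) (singular_values A)"
    have pos: "0 < op_norm A" by (rule op_norm_pos[OF \<open>A \<noteq> 0\<close>])
    have "linf_norm ?y = 1"
    proof -
      have "abs ` set ?y = (\<lambda>s. s / op_norm A) ` abs ` set ?s"
        using pos by (force simp: image_image)
      moreover have "Max ((\<lambda>s. s / op_norm A) ` abs ` set ?s) = Max (abs ` set ?s) / op_norm A"
      proof (rule mono_Max_commute[symmetric])
        show "mono (\<lambda>s. s / op_norm A)"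
          using pos by (intro monoI divide_right_mono) auto
        show "abs ` set ?s \<noteq> {}" using n len[of A] by auto
      qed simp
      ultimately have "linf_norm ?y = linf_norm ?s / op_norm A"
        by (simp only: linf_norm_def)
      then show ?thesis using pos by (simp add: linf_norm_singular_values)
    qed
    then have mem: "?y \<in> linf_sphere n" by (simp add: linf_sphere_def len)
    have "root d (chs d ?s) = root d (b * t ^ d * op_norm A ^ d)"
      using eq root_bound_eq[OF k, of "op_norm A" n t] pos by (simp add: chs_norm_def d b_def)
    then have "chs d ?s = b * t ^ d * op_norm A ^ d"
      using k d by simp
    moreover have "chs d ?y = (1 / op_norm A) ^ d * chs d ?s"
      unfolding chs_scale[symmetric] by (intro arg_cong[where f = "chs d"]) simp
    ultimately have "chs d ?y = b * t ^ d"
      using pos by (simp add: power_divide)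
    moreover have "b * t ^ d \<le> chs d x" if "x \<in> linf_sphere n" for x
      using lower[of x] that by (simp add: linf_sphere_def)
    ultimately show ?thesis using mem by (auto simp: is_arg_min_def not_less)
  qed
  have "chs_const n k * \<bar>t\<bar> * op_norm A \<le> chs_norm d A"
    using root_lower[OF len[of A]] by (simp add: chs_norm_def linf_norm_singular_values)
  with ex1 upper lower_optimal upper_optimal arg_min show ?thesis
    unfolding t_def by blast
qed

end
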